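(* For every positive integer $d$ there is a constant $k_d$ depending only on $d$ such that the following holds. Let $\mathbf{F}=(F_1,\ldots,F_d)$ be a vector of $d$ finite simple graphs, each with at most $e$ edges. If $\varepsilon > 0$ and $n> 2^{ k_d d^2e^2/\varepsilon^2}$, then \[ 0 \leq \mathrm{Vol}( P_{\mathbf{F} ; \infty}) - \mathrm{Vol}( \mathrm{conv}\, Z_{\mathbf{F};n} ) < \varepsilon, \] where $\mathrm{Vol}$ is $d$-dimensional Lebesgue measure.
   Context: $|H|$ is the number of vertices of a graph $H$. For graphs $F,G$, $t^L(F,G)$ is the number of subgraphs of $G$ (not necessarily induced) isomorphic to $F$, and $t(F,G)=t^L(F,G)/t^L(F,K_{|G|})$ if $|F|\le|G|$ and $t(F,G)=0$ otherwise, where $K_N$ is the complete graph on $N$ vertices. With $t(\mathbf{F},G)=(t(F_1,G),\ldots,t(F_d,G))$, let $P_{\mathbf{F};n}=\mathrm{conv}\{t(\mathbf{F},G)\mid G\text{ a graph on } n\text{ vertices}\}$; these are nested decreasing in $n$ for $n\ge\max_i|F_i|$, and the limit object is $P_{\mathbf{F};\infty}=\bigcap_{n\ge n_0}P_{\mathbf{F};n}$ for any $n_0\ge\max_i|F_i|$. For a graph $F$ and variables $\mathbf{x}=(x_{ij})_{i,j\in[n]}$ with $x_{ij}=x_{ji}$, let $p_{F;n}(\mathbf{x})= n^{-|F|} \sum_{\phi : V(F) \rightarrow [n]} \prod_{ij \in E(F)} x_{\phi(i)\phi(j)}$ (sum over all maps $\phi$). The curvy zonotope is $Z_{\mathbf{F};n}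 = \{ (p_{F_1;n}(\mathbf{x}), \ldots, p_{F_d;n}(\mathbf{x})) \mid \mathbf{x} \in [0,1]^{n^2},\ x_{ij}=x_{ji} \}$. *)

theory Defs
  imports "HOL-Analysis.Analysis"
begin

text \<open>A finite simple graph is represented as a pair (m, E): its vertex set is {0..<m}
  and each edge {i,j} is stored once as the ordered pair (i,j) with i < j.\<close>

type_synonym graph = "nat \<times> (nat \<times> nat) set"

definition verts :: "graph \<Rightarrow> nat" where "verts G = fst G"
definition edges :: "graph \<Rightarrow> (nat \<times> nat) set" where "edges G = snd G"

definition simple_graph :: "graph \<Rightarrow> bool" where
  "simple_graph G \<longleftrightarrow> edges G \<subseteq> {(i, j). i < j \<and> j < verts G}"

definition complete_graph :: "nat \<Rightarrow> graph" where
  "complete_graph N = (N, {(i, j). i < j \<and> j < N})"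

definition uedges :: "graph \<Rightarrow> nat set set" where
  "uedges G = (\<lambda>(i, j). {i, j}) ` edges G"

definition tL :: "graph \<Rightarrow> graph \<Rightarrow> nat" where
  "tL F G = card {(V', E'). V' \<subseteq> {0..<verts G} \<and> E' \<subseteq> uedges G \<and>
      (\<exists>\<phi>. bij_betw \<phi> {0..<verts F} V' \<and> E' = (\<lambda>(i, j). {\<phi> i, \<phi> j}) ` edges F)}"

definition tdens :: "graph \<Rightarrow> graph \<Rightarrow> real" where
  "tdens F G = (if verts F \<le> verts G
                then real (tL F G) / real (tL F (complete_graph (verts G))) else 0)"

definition Pn :: "('d::finite \<Rightarrow> graph) \<Rightarrow> nat \<Rightarrow> (real^'d) set" where
  "Pn F n = convex hull {(\<chi> i. tdens (F i) G) | G. simple_graph G \<and> verts G = n}"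

definition Pinf :: "('d::finite \<Rightarrow> graph) \<Rightarrow> (real^'d) set" where
  "Pinf F = (\<Inter>n\<in>{Max (range (\<lambda>i. verts (F i)))..}. Pn F n)"

definition hompoly :: "graph \<Rightarrow> nat \<Rightarrow> (nat \<Rightarrow> nat \<Rightarrow> real) \<Rightarrow> real" where
  "hompoly F n x = (real n) powi (- int (verts F)) *
     (\<Sum>\<phi>\<in>PiE {0..<verts F} (\<lambda>_. {0..<n}). \<Prod>(i, j)\<in>edges F. x (\<phi> i) (\<phi> j))"

definition curvy_zonotope :: "('d::finite \<Rightarrow> graph) \<Rightarrow> nat \<Rightarrow> (real^'d) set" where
  "curvy_zonotope F n = {(\<chi> k. hompoly (F k) n x) | x.
      (\<forall>i<n. \<forall>j<n. 0 \<le> x i j \<and> x i j \<le> 1 \<and> x i j = x j i)}"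

end

theory Submission
  imports Defs
begin

text \<open>With \<open>A\<close> the adjacency matrix of a graph \<open>G\<close> on \<open>N\<close> vertices, \<open>t(F, G)\<close> is the average,
  over all permutations \<open>\<pi>\<close> of the vertices, of the product of \<open>A (\<pi> i) (\<pi> j)\<close> over the edges \<open>ij\<close>
  of \<open>F\<close>. Points of the curvy zonotope are expected densities of graphs sampled from \<open>x\<close>, which
  gives the inclusion. Conversely, sampling \<open>n\<close> of the \<open>N\<close> vertices of \<open>G\<close> at random gives on
  average a point of the hull of the curvy zonotope; it differs from \<open>t(F, G)\<close> only through
  the maps \<open>\<phi>\<close> that identify two non-isolated vertices of \<open>F\<close>, hence by at most \<open>4 e\<^sup>2 / n\<close>. So no
  regularity lemma is needed, and \<open>n\<close> of order \<open>e\<^sup>2 / \<epsilon>\<close> already suffices. Finally,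
  enlarging a convex subset of the unit cube by \<open>r\<close> in every coordinate direction
  increases its volume by at most a constant times \<open>r\<close>.\<close>

section \<open>Volume of enlarged convex sets\<close>

text \<open>The Minkowski sum of \<open>K\<close> with the segment from 0 to \<open>v\<close>, in
  the shape in which \<open>convex_sums\<close> and \<open>bounded_sums\<close> state such
  sums.\<close>

definition sweep :: "'a::real_vector set \<Rightarrow> 'a \<Rightarrow> 'a set" where
  "sweep K v = (\<Union>x\<in>K. \<Union>y\<in>closed_segment 0 v. {x + y})"

lemma mem_sweep: "z \<in> sweep K v \<longleftrightarrow> (\<exists>x\<in>K. \<exists>s. 0 \<le> s \<and> s \<le> 1 \<and> z = x + s *\<^sub>R v)"
  by (auto simp: sweep_def closed_segment_def)

lemma convex_sweep: "convex K \<Longrightarrow> convex (sweep K v)"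
  unfolding sweep_def by (intro convex_sums) auto

lemma subset_sweep: "K \<subseteq> sweep K v"
  by (force simp: mem_sweep)

lemma bounded_sweep:
  fixes K :: "'a::euclidean_space set"
  shows "bounded K \<Longrightarrow> bounded (sweep K v)"
  unfolding sweep_def by (intro bounded_sums) (auto simp: bounded_closed_segment)

lemma sweep_lmeasurable:
  fixes K :: "'a::euclidean_space set"
  shows "convex K \<Longrightarrow> bounded K \<Longrightarrow> sweep K v \<in> lmeasurable"
  by (intro measurable_convex convex_sweep bounded_sweep)

text \<open>The translates of \<open>sweep K v - K\<close> by multiples of \<open>v\<close> are pairwise disjoint, because every
  line parallel to \<open>v\<close> meets \<open>K\<close> in an interval. This avoids slicing \<open>K\<close> by Fubini.\<close>

lemma sweep_layers_disjoint:
  assumes "convex K" "i < j"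
  shows "disjnt ((+) (real i *\<^sub>R v) ` (sweep K v - K)) ((+) (real j *\<^sub>R v) ` (sweep K v - K))"
proof (rule ccontr)
  assume "\<not> ?thesis"
  then obtain a b where a: "a \<in> sweep K v" "a \<notin> K" and b: "b \<in> sweep K v" "b \<notin> K"
    and eq: "real i *\<^sub>R v + a = real j *\<^sub>R v + b"
    by (auto simp: disjnt_iff)
  obtain p s where p: "p \<in> K" "0 \<le> s" "s \<le> 1" "a = p + s *\<^sub>R v"
    using a by (auto simp: mem_sweep)
  obtain q t where q: "q \<in> K" "0 \<le> t" "t \<le> 1" "b = q + t *\<^sub>R v"
    using b by (auto simp: mem_sweep)
  \<comment> \<open>In direction \<open>v\<close>, \<open>q\<close> lies \<open>t\<close> before
    \<open>b\<close> and \<open>p\<close> lies \<open>u\<close> after it, where \<open>u\<close>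
    \<ge> 0 because \<open>j - i\<close> \<ge> 1 \<ge> \<open>s\<close>. Convexity then puts
    \<open>b\<close> into \<open>K\<close>, a contradiction.\<close>
  define u where "u = real j - real i - s"
  have "0 \<le> u" using assms(2) p by (simp add: u_def)
  have pb: "p = b + u *\<^sub>R v"
    using eq p(4) by (simp add: u_def algebra_simps)
  have "t > 0" using q b by (cases "t = 0") auto
  have "u / (u + t) + t / (u + t) = 1"
    using \<open>0 \<le> u\<close> \<open>t > 0\<close> by (simp flip: add_divide_distrib)
  hence pq: "(u / (u + t)) *\<^sub>R q + (t / (u + t)) *\<^sub>R p \<in> K"
    using \<open>0 \<le> u\<close> \<open>t > 0\<close> p q \<open>convex K\<close> by (intro convexD) auto
  have "(u + t) *\<^sub>R ((u / (u + t)) *\<^sub>R q + (t / (u + t)) *\<^sub>R p) = u *\<^sub>R q + t *\<^sub>R p"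
    using \<open>0 \<le> u\<close> \<open>t > 0\<close> by (simp add: scaleR_add_right)
  also have "\<dots> = (u + t) *\<^sub>R b"
    unfolding pb q(4) by (simp add: algebra_simps)
  finally have "(u + t) *\<^sub>R ((u / (u + t)) *\<^sub>R q + (t / (u + t)) *\<^sub>R p) = (u + t) *\<^sub>R b" .
  hence "(u / (u + t)) *\<^sub>R q + (t / (u + t)) *\<^sub>R p = b"
    using \<open>0 \<le> u\<close> \<open>t > 0\<close> by (subst (asm) scaleR_cancel_left) auto
  with pq b show False by simp
qed

text \<open>The \<open>m\<close> translates of \<open>sweep K v - K\<close> by 0, \<open>v\<close>,
  ..., \<open>(m - 1) v\<close> are disjoint and all fit into the sweep of \<open>K\<close> along
  \<open>m v\<close>.\<close>

lemma measure_sweep_le: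
  fixes K :: "'a::euclidean_space set"
  assumes "convex K" "bounded K"
  shows "real m * (measure lebesgue (sweep K v) - measure lebesgue K)
           \<le> measure lebesgue (sweep K (real m *\<^sub>R v))"
proof (cases "m = 0")
  case False
  let ?A = "sweep K v - K"
  let ?T = "\<lambda>i. (+) (real i *\<^sub>R v) ` ?A"
  have K: "K \<in> lmeasurable" by (rule measurable_convex[OF assms])
  have S: "sweep K w \<in> lmeasurable" for w using assms by (rule sweep_lmeasurable)
  have A: "?A \<in> lmeasurable" using K S by blast
  have T: "?T i \<in> lmeasurable" for i using A by (rule measurable_translation)
  have disj: "pairwise (\<lambda>i j. disjnt (?T i) (?T j)) {..<m}"
    unfolding pairwise_def
    by (metis assms(1) disjnt_sym linorder_neqE_nat sweep_layers_disjoint)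
  have sub: "(\<Union>i<m. ?T i) \<subseteq> sweep K (real m *\<^sub>R v)"
  proof clarify
    fix i a assume "i < m" "a \<in> sweep K v"
    then obtain p s where p: "p \<in> K" "0 \<le> s" "s \<le> 1" "a = p + s *\<^sub>R v"
      by (auto simp: mem_sweep)
    have "real i *\<^sub>R v + a = p + (real i + s) *\<^sub>R v"
      by (simp add: p(4) algebra_simps)
    hence "real i *\<^sub>R v + a = p + ((real i + s) / real m) *\<^sub>R (real m *\<^sub>R v)"
      using \<open>i < m\<close> by simp
    moreover have "0 \<le> (real i + s) / real m" "(real i + s) / real m \<le> 1"
      using \<open>i < m\<close> p by (auto simp: field_simps)
    ultimately show "real i *\<^sub>R v + a \<in> sweep K (real m *\<^sub>R v)"
      using p(1) unfolding mem_sweep by blast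
  qed
  have "real m * (measure lebesgue (sweep K v) - measure lebesgue K) = real m * measure lebesgue ?A"
    using measurable_measure_Diff[OF S _ subset_sweep] K by (simp add: fmeasurableD)
  also have "\<dots> = (\<Sum>i<m. measure lebesgue (?T i))"
    by (simp add: measure_translation)
  also have "\<dots> = measure lebesgue (\<Union>i<m. ?T i)"
    using T disj by (intro measure_UNION'[symmetric]) auto
  also have "\<dots> \<le> measure lebesgue (sweep K (real m *\<^sub>R v))"
    using T S sub by (intro measure_mono_fmeasurable) (auto intro!: fmeasurableD)
  finally show ?thesis .
qed simp

text \<open>About 1/\<delta> sweeps of length \<delta> stay in a cube of side 3, so \<open>m\<close>
  times the gain of one sweep is at most \<open>3 ^ DIM('a)\<close>. With 2\<delta> \<le> 1,
  rounding 1/\<delta> down loses at most a factor 2. The cube of side 2 leaves room for directions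
  swept before.\<close>

lemma measure_sweep_Basis_le:
  fixes K :: "'a::euclidean_space set"
  assumes K: "convex K" "K \<subseteq> cbox 0 (2 *\<^sub>R One)" and i: "i \<in> Basis" and \<delta>: "0 < \<delta>" "2 * \<delta> \<le> 1"
  shows "measure lebesgue (sweep K (\<delta> *\<^sub>R i)) \<le> measure lebesgue K + 3 ^ DIM('a) * 2 * \<delta>"
proof -
  define m where "m = nat \<lfloor>1 / \<delta>\<rfloor>"
  have m: "real m \<le> 1 / \<delta>" "real m > 1 / \<delta> - 1"
    using \<delta> by (auto simp: m_def)
  have m1: "real m * \<delta> \<le> 1" using m \<delta> by (simp add: field_simps)
  have "1 / \<delta> - 1 \<ge> 1 / (2 * \<delta>)" using \<delta> by (simp add: field_simps)
  hence m2: "real m \<ge> 1 / (2 * \<delta>)" using m by linarith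
  hence "real m * (2 * \<delta>) \<ge> 1" using \<delta> by (simp add: field_simps)
  have bK: "bounded K" using K(2) bounded_cbox bounded_subset by blast
  have "sweep K (real m *\<^sub>R \<delta> *\<^sub>R i) \<subseteq> cbox 0 (3 *\<^sub>R One)"
  proof
    fix z assume "z \<in> sweep K (real m *\<^sub>R \<delta> *\<^sub>R i)"
    then obtain p s where p: "p \<in> K" "0 \<le> s" "s \<le> 1" "z = p + (s * (real m * \<delta>)) *\<^sub>R i"
      by (auto simp: mem_sweep)
    have "0 \<le> s * (real m * \<delta>)" "s * (real m * \<delta>) \<le> 1"
      using p m1 \<delta> by (auto intro!: mult_le_one)
    moreover have "\<forall>b\<in>Basis. 0 \<le> p \<bullet> b \<and> p \<bullet> b \<le> 2"
      using p(1) K(2) by (auto simp: mem_box)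
    ultimately show "z \<in> cbox 0 (3 *\<^sub>R One)"
      using i by (auto simp: mem_box p(4) inner_simps inner_Basis)
  qed
  hence "measure lebesgue (sweep K (real m *\<^sub>R \<delta> *\<^sub>R i)) \<le> measure lebesgue (cbox 0 (3 *\<^sub>R One :: 'a))"
    using sweep_lmeasurable[OF K(1) bK] by (intro measure_mono_fmeasurable) (auto intro: fmeasurableD)
  also have "\<dots> = 3 ^ DIM('a)"
    using content_cbox_plus[of "0::'a" 3] by simp
  finally have le: "real m * (measure lebesgue (sweep K (\<delta> *\<^sub>R i)) - measure lebesgue K) \<le> 3 ^ DIM('a)"
    using measure_sweep_le[OF K(1) bK, of m "\<delta> *\<^sub>R i"] by linarith
  let ?D = "measure lebesgue (sweep K (\<delta> *\<^sub>R i)) - measure lebesgue K"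
  have D: "?D \<ge> 0"
    using measure_mono_fmeasurable[OF subset_sweep[of K "\<delta> *\<^sub>R i"]] sweep_lmeasurable[OF K(1) bK]
      measurable_convex[OF K(1) bK] by (simp add: fmeasurableD)
  have "?D \<le> (real m * (2 * \<delta>)) * ?D"
    using D \<open>real m * (2 * \<delta>) \<ge> 1\<close> mult_right_mono[of 1 "real m * (2 * \<delta>)" ?D] by simp
  also have "\<dots> = (real m * ?D) * (2 * \<delta>)" by simp
  also have "\<dots> \<le> 3 ^ DIM('a) * (2 * \<delta>)" using le \<delta> by (intro mult_right_mono) auto
  finally show ?thesis by simp
qed

section \<open>Minkowski sums with coordinate boxes\<close>

text \<open>The Minkowski sum of \<open>K\<close> with a box of side \<delta> in the directions of
  \<open>S\<close>. The box is one-sided so that it arises by successive sweeps, and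
  \<open>S\<close> is a parameter so that directions can be added one at a time.\<close>

definition box_sum :: "real \<Rightarrow> 'a::euclidean_space set \<Rightarrow> 'a set \<Rightarrow> 'a set" where
  "box_sum \<delta> S K = {x + (\<Sum>i\<in>S. c i *\<^sub>R i) | x c. x \<in> K \<and> (\<forall>i\<in>S. 0 \<le> c i \<and> c i \<le> \<delta>)}"

lemma box_sum_insert:
  assumes "finite S" "i \<notin> S" "\<delta> > 0"
  shows "box_sum \<delta> (insert i S) K = sweep (box_sum \<delta> S K) (\<delta> *\<^sub>R i)"
proof (rule set_eqI, rule iffI)
  fix z assume "z \<in> box_sum \<delta> (insert i S) K"
  then obtain x c where x: "x \<in> K" "\<forall>j\<in>insert i S. 0 \<le> c j \<and> c j \<le> \<delta>"
    and z: "z = x + (\<Sum>j\<in>insert i S. c j *\<^sub>R j)"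
    unfolding box_sum_def by blast
  have "z = (x + (\<Sum>j\<in>S. c j *\<^sub>R j)) + (c i / \<delta>) *\<^sub>R (\<delta> *\<^sub>R i)"
    using assms by (simp add: z)
  moreover have "x + (\<Sum>j\<in>S. c j *\<^sub>R j) \<in> box_sum \<delta> S K"
    using x unfolding box_sum_def by blast
  moreover have "0 \<le> c i / \<delta>" "c i / \<delta> \<le> 1" using x assms by auto
  ultimately show "z \<in> sweep (box_sum \<delta> S K) (\<delta> *\<^sub>R i)"
    unfolding mem_sweep by blast
next
  fix z assume "z \<in> sweep (box_sum \<delta> S K) (\<delta> *\<^sub>R i)"
  then obtain x c s where x: "x \<in> K" "\<forall>j\<in>S. 0 \<le> c j \<and> c j \<le> \<delta>" "0 \<le> s" "s \<le> 1"
    and z: "z = x + (\<Sum>j\<in>S. c j *\<^sub>R j) + s *\<^sub>R \<delta> *\<^sub>R i"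
    unfolding box_sum_def mem_sweep by blast
  define c' where "c' = c(i := s * \<delta>)"
  have "(\<Sum>j\<in>S. c' j *\<^sub>R j) = (\<Sum>j\<in>S. c j *\<^sub>R j)"
    using assms by (intro sum.cong) (auto simp: c'_def)
  hence "z = x + (\<Sum>j\<in>insert i S. c' j *\<^sub>R j)"
    using assms by (simp add: z c'_def)
  moreover have "\<forall>j\<in>insert i S. 0 \<le> c' j \<and> c' j \<le> \<delta>"
    using x assms by (auto simp: c'_def mult_left_le_one_le)
  ultimately show "z \<in> box_sum \<delta> (insert i S) K"
    using x(1) unfolding box_sum_def by blast
qed

text \<open>Keeps all intermediate sets of the induction over directions within the cube that
  \<open>measure_sweep_Basis_le\<close> requires.\<close>

lemma box_sum_subset_cbox:
  fixes K :: "'a::euclidean_space set"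
  assumes "K \<subseteq> cbox 0 One" "S \<subseteq> Basis" "\<delta> \<le> 1"
  shows "box_sum \<delta> S K \<subseteq> cbox 0 (2 *\<^sub>R One)"
proof
  fix z assume "z \<in> box_sum \<delta> S K"
  then obtain x c where x: "x \<in> K" "\<forall>j\<in>S. 0 \<le> c j \<and> c j \<le> \<delta>" and z: "z = x + (\<Sum>j\<in>S. c j *\<^sub>R j)"
    unfolding box_sum_def by blast
  have fin: "finite S" using assms(2) finite_Basis finite_subset by blast
  show "z \<in> cbox 0 (2 *\<^sub>R One)"
  proof (clarsimp simp: mem_box)
    fix b :: 'a assume b: "b \<in> Basis"
    have "(\<Sum>j\<in>S. c j *\<^sub>R j) \<bullet> b = (\<Sum>j\<in>S. if j = b then c j else 0)"
      unfolding inner_sum_left using assms(2) b by (intro sum.cong) (auto simp: inner_Basis)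
    also have "\<dots> = (if b \<in> S then c b else 0)" using fin by simp
    finally have "z \<bullet> b = x \<bullet> b + (if b \<in> S then c b else 0)" by (simp add: z inner_simps)
    moreover have "0 \<le> x \<bullet> b" "x \<bullet> b \<le> 1" using x(1) assms(1) b by (auto simp: mem_box)
    ultimately show "0 \<le> z \<bullet> b \<and> z \<bullet> b \<le> 2" using x(2) assms(3) by force
  qed
qed

text \<open>Each direction is one sweep and costs at most \<open>3 ^ DIM('a) * 2 * \<delta>\<close>.
  Convexity is carried along because the next sweep requires it.\<close>

lemma measure_box_sum_le:
  fixes K :: "'a::euclidean_space set"
  assumes "convex K" "K \<subseteq> cbox 0 One" "0 < \<delta>" "2 * \<delta> \<le> 1" "S \<subseteq> Basis"
  shows "convex (box_sum \<delta> S K) \<and>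
    measure lebesgue (box_sum \<delta> S K) \<le> measure lebesgue K + real (card S) * (3 ^ DIM('a) * 2 * \<delta>)"
proof -
  have "finite S" using assms(5) finite_Basis finite_subset by blast
  from this assms(5) show ?thesis
  proof (induction S rule: finite_induct)
    case empty
    have "box_sum \<delta> {} K = K" by (auto simp: box_sum_def)
    with assms(1) show ?case by simp
  next
    case (insert i S)
    hence IH: "convex (box_sum \<delta> S K)"
      "measure lebesgue (box_sum \<delta> S K) \<le> measure lebesgue K + real (card S) * (3 ^ DIM('a) * 2 * \<delta>)"
      by auto
    have "measure lebesgue (sweep (box_sum \<delta> S K) (\<delta> *\<^sub>R i))
        \<le> measure lebesgue (box_sum \<delta> S K) + 3 ^ DIM('a) * 2 * \<delta>"
      using insert assms IH by (intro measure_sweep_Basis_le box_sum_subset_cbox) auto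
    with IH insert assms show ?case
      by (auto simp: box_sum_insert convex_sweep algebra_simps)
  qed
qed

text \<open>Shifting \<open>L\<close> by \<open>r\<close> in every coordinate turns deviations in
  [-r, r] into deviations in [0, 2r]. The shifted set, of the same measure, therefore lies in the
  one-sided box sum with \<delta> = 2r.\<close>

proposition measure_le_of_near_convex:
  fixes K L :: "'a::euclidean_space set" and r :: real
  assumes K: "convex K" "K \<subseteq> cbox 0 One" and L: "L \<in> lmeasurable" and r: "0 < r" "4 * r \<le> 1"
    and near: "\<And>x. x \<in> L \<Longrightarrow> \<exists>y\<in>K. \<forall>b\<in>Basis. \<bar>x \<bullet> b - y \<bullet> b\<bar> \<le> r"
  shows "measure lebesgue L \<le> measure lebesgue K + DIM('a) * 3 ^ DIM('a) * 4 * r"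
proof -
  let ?B = "box_sum (2 * r) Basis K"
  have B: "convex ?B" "measure lebesgue ?B \<le> measure lebesgue K + DIM('a) * (3 ^ DIM('a) * 2 * (2 * r))"
    using measure_box_sum_le[OF K, of "2 * r" Basis] r by auto
  have bB: "?B \<in> lmeasurable"
    using box_sum_subset_cbox[OF K(2), of Basis "2 * r"] r B(1)
    by (intro measurable_convex) (auto intro: bounded_subset[OF bounded_cbox])
  have "(+) (r *\<^sub>R One) ` L \<subseteq> ?B"
  proof clarify
    fix x assume "x \<in> L"
    then obtain y where y: "y \<in> K" "\<forall>b\<in>Basis. \<bar>x \<bullet> b - y \<bullet> b\<bar> \<le> r" using near by blast
    define c where "c = (\<lambda>b. x \<bullet> b - y \<bullet> b + r)"
    have "r *\<^sub>R One + x = y + (\<Sum>b\<in>Basis. c b *\<^sub>R b)"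
      by (rule euclidean_eqI) (simp add: inner_simps c_def)
    moreover have "\<forall>b\<in>Basis. 0 \<le> c b \<and> c b \<le> 2 * r" using y(2) by (auto simp: c_def abs_le_iff)
    ultimately show "r *\<^sub>R One + x \<in> ?B" using y(1) unfolding box_sum_def by blast
  qed
  hence "measure lebesgue ((+) (r *\<^sub>R One) ` L) \<le> measure lebesgue ?B"
    using L bB by (intro measure_mono_fmeasurable) (auto intro: fmeasurableD measurable_translation)
  hence "measure lebesgue L \<le> measure lebesgue ?B"
    by (simp only: measure_translation)
  with B(2) show ?thesis by (simp add: mult_ac)
qed

section \<open>Densities as averages over permutations\<close>

text \<open>The complements of \<open>S\<close> and of its image in \<open>A\<close> have equal
  size, so any bijection between them completes \<phi>.\<close>

lemma extend_inj_to_permutation: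
  assumes "finite A" "S \<subseteq> A" "\<phi> ` S \<subseteq> A" "inj_on \<phi> S"
  obtains \<sigma> where "\<sigma> permutes A" "\<And>x. x \<in> S \<Longrightarrow> \<sigma> x = \<phi> x"
proof -
  have "card (A - S) = card (A - \<phi> ` S)"
    using assms finite_subset[OF assms(2,1)] by (simp add: card_Diff_subset card_image)
  then obtain g where g: "bij_betw g (A - S) (A - \<phi> ` S)"
    using finite_same_card_bij[of "A - S" "A - \<phi> ` S"] assms(1) by auto
  define \<sigma> where "\<sigma> x = (if x \<in> S then \<phi> x else if x \<in> A then g x else x)" for x
  have "bij_betw \<sigma> S (\<phi> ` S)"
    using assms(4) by (auto simp: \<sigma>_def bij_betw_def inj_on_def)
  moreover have "bij_betw \<sigma> (A - S) (A - \<phi> ` S)"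
    using g by (subst bij_betw_cong[of _ _ g]) (auto simp: \<sigma>_def)
  ultimately have "bij_betw \<sigma> (S \<union> (A - S)) (\<phi> ` S \<union> (A - \<phi> ` S))"
    by (rule bij_betw_combine) auto
  hence "bij_betw \<sigma> A A" using assms by (simp add: Un_absorb1)
  hence "\<sigma> permutes A"
    using assms(2) by (intro bij_imp_permutes) (auto simp: \<sigma>_def)
  thus ?thesis by (rule that) (simp add: \<sigma>_def)
qed

text \<open>Unordered pairs make this symmetric, although \<open>edges\<close> stores each edge only
  with increasing endpoints.\<close>

definition adj :: "graph \<Rightarrow> nat \<Rightarrow> nat \<Rightarrow> real" where
  "adj G u v = of_bool ({u, v} \<in> uedges G)"

text \<open>For \<open>verts F\<close> \<le> \<open>N\<close> this is the injective homomorphism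
  density. Averaging over permutations of all \<open>N\<close> vertices gives one probability space
  common to all graphs \<open>F\<close>.\<close>

definition perm_avg :: "graph \<Rightarrow> nat \<Rightarrow> (nat \<Rightarrow> nat \<Rightarrow> real) \<Rightarrow> real" where
  "perm_avg F N y =
    (\<Sum>\<pi> | \<pi> permutes {0..<N}. \<Prod>(i, j)\<in>edges F. y (\<pi> i) (\<pi> j)) / fact N"

definition copy_of :: "graph \<Rightarrow> (nat \<Rightarrow> nat) \<Rightarrow> nat set \<times> nat set set" where
  "copy_of F \<pi> = (\<pi> ` {0..<verts F}, (\<lambda>(i, j). {\<pi> i, \<pi> j}) ` edges F)"

lemma simple_graph_edge: "simple_graph F \<Longrightarrow> (i, j) \<in> edges F \<Longrightarrow> i < j \<and> j < verts F"
  by (auto simp: simple_graph_def)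

lemma finite_edges: "simple_graph F \<Longrightarrow> finite (edges F)"
  by (rule finite_subset[of _ "{0..<verts F} \<times> {0..<verts F}"]) (auto dest: simple_graph_edge)

lemma mem_uedges_complete: "{u, v} \<in> uedges (complete_graph N) \<longleftrightarrow> u \<noteq> v \<and> u < N \<and> v < N"
proof
  assume "{u, v} \<in> uedges (complete_graph N)"
  then show "u \<noteq> v \<and> u < N \<and> v < N"
    by (auto simp: uedges_def complete_graph_def edges_def doubleton_eq_iff)
next
  assume "u \<noteq> v \<and> u < N \<and> v < N"
  then show "{u, v} \<in> uedges (complete_graph N)"
    unfolding uedges_def complete_graph_def edges_def
    by (intro image_eqI[of _ _ "(min u v, max u v)"]) (auto simp: min_def max_def)
qed

text \<open>An embedding of the vertices of \<open>F\<close> extends to a permutation of the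
  vertices of \<open>G\<close>, so the images of \<open>F\<close> under permutations already give
  all copies.\<close>

lemma tL_eq_card_copies:
  assumes F: "simple_graph F" "verts F \<le> verts G"
  shows "tL F G = card (copy_of F ` {\<pi>. \<pi> permutes {0..<verts G} \<and> snd (copy_of F \<pi>) \<subseteq> uedges G})"
  unfolding tL_def
proof (rule arg_cong[where f = card], rule set_eqI, clarify)
  fix V' E'
  let ?A = "{0..<verts G}" and ?P = "{\<pi>. \<pi> permutes {0..<verts G} \<and> snd (copy_of F \<pi>) \<subseteq> uedges G}"
  have "(\<exists>\<pi>. \<pi> permutes ?A \<and> snd (copy_of F \<pi>) \<subseteq> uedges G \<and> (V', E') = copy_of F \<pi>) \<longleftrightarrow>
    V' \<subseteq> ?A \<and> E' \<subseteq> uedges G \<and>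
    (\<exists>\<phi>. bij_betw \<phi> {0..<verts F} V' \<and> E' = (\<lambda>(i, j). {\<phi> i, \<phi> j}) ` edges F)" (is "?L \<longleftrightarrow> ?R")
  proof
    assume ?L
    then obtain \<pi> where \<pi>: "\<pi> permutes ?A" "snd (copy_of F \<pi>) \<subseteq> uedges G" "(V', E') = copy_of F \<pi>"
      by blast
    have "\<pi> ` {0..<verts F} \<subseteq> ?A"
      using F(2) permutes_image[OF \<pi>(1)] image_mono[of "{0..<verts F}" ?A \<pi>] by auto
    moreover have "bij_betw \<pi> {0..<verts F} (\<pi> ` {0..<verts F})"
      using permutes_inj_on[OF \<pi>(1)] by (rule inj_on_imp_bij_betw)
    ultimately show ?R using \<pi>(2,3) by (auto simp: copy_of_def)
  next
    assume ?R
    then obtain \<phi> where V: "V' \<subseteq> ?A" "E' \<subseteq> uedges G" and \<phi>: "bij_betw \<phi> {0..<verts F} V'"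
      and E: "E' = (\<lambda>(i, j). {\<phi> i, \<phi> j}) ` edges F" by blast
    have "inj_on \<phi> {0..<verts F}" "\<phi> ` {0..<verts F} = V'" using \<phi> by (auto simp: bij_betw_def)
    then obtain \<sigma> where \<sigma>: "\<sigma> permutes ?A" "\<And>x. x \<in> {0..<verts F} \<Longrightarrow> \<sigma> x = \<phi> x"
      using extend_inj_to_permutation[of ?A "{0..<verts F}" \<phi>] V(1) F(2) by auto
    have "copy_of F \<sigma> = copy_of F \<phi>"
    proof -
      have "{\<sigma> i, \<sigma> j} = {\<phi> i, \<phi> j}" if "(i, j) \<in> edges F" for i j
        using simple_graph_edge[OF F(1) that] \<sigma>(2) by simp
      thus ?thesis using \<sigma>(2) by (auto simp: copy_of_def intro!: image_cong)
    qed
    also have "\<dots> = (V', E')"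
      using E \<open>\<phi> ` {0..<verts F} = V'\<close> by (simp add: copy_of_def)
    finally show ?L using \<sigma>(1) V(2) by (intro exI[of _ \<sigma>]) auto
  qed
  then show "((V', E') \<in> {(V', E'). V' \<subseteq> ?A \<and> E' \<subseteq> uedges G \<and>
    (\<exists>\<phi>. bij_betw \<phi> {0..<verts F} V' \<and> E' = (\<lambda>(i, j). {\<phi> i, \<phi> j}) ` edges F)}) =
    ((V', E') \<in> copy_of F ` ?P)"
    by (simp add: image_iff conj_assoc)
qed

text \<open>All copies of \<open>F\<close> arise from equally many permutations, since left multiplication by a
  permutation maps the fibre over one copy onto the fibre over another.\<close>

lemma card_copy_fibre:
  assumes "\<pi>\<^sub>0 permutes A"
  shows "card {\<pi>. \<pi> permutes A \<and> copy_of F \<pi> = copy_of F \<pi>\<^sub>0} =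
         card {\<pi>. \<pi> permutes A \<and> copy_of F \<pi> = copy_of F id}"
proof -
  \<comment> \<open>The action of \<open>\<pi>\<^sub>0\<close> on subgraphs. \<open>copy_of\<close>
    is equivariant under it, and injectivity of \<open>act\<close> allows
    \<open>\<pi>\<^sub>0\<close> to be cancelled.\<close>
  define act where "act = (\<lambda>(V, E). (\<pi>\<^sub>0 ` V, (\<lambda>D. \<pi>\<^sub>0 ` D) ` E) :: nat set \<times> nat set set)"
  have inj: "inj \<pi>\<^sub>0" using assms by (rule permutes_inj)
  have "inj act"
  proof (rule injI, clarify)
    fix V E V' E' assume "act (V, E) = act (V', E')"
    then have "\<pi>\<^sub>0 ` V = \<pi>\<^sub>0 ` V'" "image \<pi>\<^sub>0 ` E = image \<pi>\<^sub>0 ` E'" by (auto simp: act_def)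
    moreover have "inj (image \<pi>\<^sub>0)" using inj by (simp add: inj_image_eq_iff inj_def[of "image \<pi>\<^sub>0"])
    ultimately show "V = V' \<and> E = E'" using inj by (simp add: inj_image_eq_iff)
  qed
  have act: "copy_of F (\<pi>\<^sub>0 \<circ> \<pi>) = act (copy_of F \<pi>)" for \<pi>
    by (simp add: copy_of_def act_def image_comp o_def split_beta)
  have "{\<pi>. \<pi> permutes A \<and> copy_of F \<pi> = copy_of F \<pi>\<^sub>0} =
    (\<lambda>\<pi>. \<pi>\<^sub>0 \<circ> \<pi>) ` {\<pi>. \<pi> permutes A \<and> copy_of F \<pi> = copy_of F id}"
  proof (rule set_eqI, rule iffI)
    fix \<pi> assume \<pi>: "\<pi> \<in> {\<pi>. \<pi> permutes A \<and> copy_of F \<pi> = copy_of F \<pi>\<^sub>0}"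
    have eq: "\<pi> = \<pi>\<^sub>0 \<circ> (inv \<pi>\<^sub>0 \<circ> \<pi>)"
      by (simp add: fun_eq_iff permutes_inverses(1)[OF assms])
    have "act (copy_of F (inv \<pi>\<^sub>0 \<circ> \<pi>)) = copy_of F \<pi>"
      using act[of "inv \<pi>\<^sub>0 \<circ> \<pi>"] by (simp flip: eq)
    also have "\<dots> = act (copy_of F id)"
      using \<pi> act[of id] by simp
    finally have "act (copy_of F (inv \<pi>\<^sub>0 \<circ> \<pi>)) = act (copy_of F id)" .
    hence "copy_of F (inv \<pi>\<^sub>0 \<circ> \<pi>) = copy_of F id" using \<open>inj act\<close> by (simp add: inj_eq)
    moreover have "inv \<pi>\<^sub>0 \<circ> \<pi> permutes A"
      using \<pi> assms by (simp add: permutes_compose permutes_inv)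
    ultimately show "\<pi> \<in> (\<lambda>\<pi>. \<pi>\<^sub>0 \<circ> \<pi>) ` {\<pi>. \<pi> permutes A \<and> copy_of F \<pi> = copy_of F id}"
      using eq by blast
  next
    fix \<pi> assume "\<pi> \<in> (\<lambda>\<pi>. \<pi>\<^sub>0 \<circ> \<pi>) ` {\<pi>. \<pi> permutes A \<and> copy_of F \<pi> = copy_of F id}"
    then show "\<pi> \<in> {\<pi>. \<pi> permutes A \<and> copy_of F \<pi> = copy_of F \<pi>\<^sub>0}"
      using act act[of id] assms by (auto intro: permutes_compose)
  qed
  moreover have "inj_on (\<lambda>\<pi>. \<pi>\<^sub>0 \<circ> \<pi>) X" for X :: "(nat \<Rightarrow> nat) set"
    using fun.inj_map[OF inj] by (rule inj_on_subset) simp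
  ultimately show ?thesis by (simp add: card_image)
qed

text \<open>The condition on \<pi> depends only on the copy, so the set is a union of whole fibres,
  which all have the same size.\<close>

lemma card_perms_eq_copies:
  assumes "finite A"
  shows "card {\<pi>. \<pi> permutes A \<and> snd (copy_of F \<pi>) \<subseteq> U} =
    card (copy_of F ` {\<pi>. \<pi> permutes A \<and> snd (copy_of F \<pi>) \<subseteq> U}) *
    card {\<pi>. \<pi> permutes A \<and> copy_of F \<pi> = copy_of F id}"
proof -
  let ?P = "{\<pi>. \<pi> permutes A \<and> snd (copy_of F \<pi>) \<subseteq> U}"
  have "finite ?P" by (rule finite_subset[OF _ finite_permutations[OF assms]]) auto
  hence "card ?P = (\<Sum>c\<in>copy_of F ` ?P. card {\<pi>\<in>?P. copy_of F \<pi> = c})"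
    unfolding card_eq_sum by (rule sum.image_gen)
  also have "\<dots> = (\<Sum>c\<in>copy_of F ` ?P. card {\<pi>. \<pi> permutes A \<and> copy_of F \<pi> = copy_of F id})"
  proof (rule sum.cong[OF refl])
    fix c assume "c \<in> copy_of F ` ?P"
    then obtain \<pi>\<^sub>0 where \<pi>\<^sub>0: "\<pi>\<^sub>0 permutes A" "snd (copy_of F \<pi>\<^sub>0) \<subseteq> U" "c = copy_of F \<pi>\<^sub>0" by blast
    hence "{\<pi>\<in>?P. copy_of F \<pi> = c} = {\<pi>. \<pi> permutes A \<and> copy_of F \<pi> = copy_of F \<pi>\<^sub>0}" by auto
    thus "card {\<pi>\<in>?P. copy_of F \<pi> = c} = card {\<pi>. \<pi> permutes A \<and> copy_of F \<pi> = copy_of F id}"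
      using card_copy_fibre[OF \<pi>\<^sub>0(1)] by simp
  qed
  finally show ?thesis by simp
qed

lemma prod_adj:
  assumes "finite (edges F)"
  shows "(\<Prod>(i, j)\<in>edges F. adj G (\<pi> i) (\<pi> j)) = of_bool (snd (copy_of F \<pi>) \<subseteq> uedges G)"
proof (cases "snd (copy_of F \<pi>) \<subseteq> uedges G")
  case True
  then show ?thesis by (auto simp: copy_of_def adj_def intro!: prod.neutral)
next
  case False
  then have "\<exists>a\<in>edges F. (case a of (i, j) \<Rightarrow> adj G (\<pi> i) (\<pi> j)) = 0"
    by (force simp: copy_of_def adj_def)
  with assms False show ?thesis by (auto simp: prod_zero_iff)
qed

text \<open>With \<open>k\<close> the common fibre size, \<open>tL F G * k\<close> permutations map
  \<open>F\<close> into \<open>G\<close>, and all \<open>N!\<close> permutations map it into the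
  complete graph. The factor \<open>k\<close> cancels in the quotient; it is positive because of the
  identity.\<close>

lemma tdens_eq_perm_avg:
  assumes F: "simple_graph F" "verts F \<le> verts G"
  shows "tdens F G = perm_avg F (verts G) (adj G)"
proof -
  let ?A = "{0..<verts G}" and ?K = "complete_graph (verts G)"
  let ?P = "\<lambda>U. {\<pi>. \<pi> permutes ?A \<and> snd (copy_of F \<pi>) \<subseteq> U}"
  define k where "k = card {\<pi>. \<pi> permutes ?A \<and> copy_of F \<pi> = copy_of F id}"
  have fin: "finite {\<pi>. \<pi> permutes ?A}" by (rule finite_permutations) simp
  have "finite {\<pi>. \<pi> permutes ?A \<and> copy_of F \<pi> = copy_of F id}"
    by (rule finite_subset[OF _ fin]) auto
  moreover have "id \<in> {\<pi>. \<pi> permutes ?A \<and> copy_of F \<pi> = copy_of F id}"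
    by (simp add: permutes_id)
  ultimately have k: "k > 0"
    unfolding k_def card_gt_0_iff by blast
  have vK: "verts ?K = verts G" by (simp add: complete_graph_def verts_def)
  have "snd (copy_of F \<pi>) \<subseteq> uedges ?K" if \<pi>: "\<pi> permutes ?A" for \<pi>
  proof -
    have "{\<pi> i, \<pi> j} \<in> uedges ?K" if "(i, j) \<in> edges F" for i j
    proof -
      have "i < j" "j < verts F" using simple_graph_edge[OF F(1) that] by auto
      thus ?thesis
        using permutes_in_image[OF \<pi>, of i] permutes_in_image[OF \<pi>, of j] permutes_inj[OF \<pi>] F(2)
        by (auto simp: mem_uedges_complete inj_eq)
    qed
    thus ?thesis by (auto simp: copy_of_def)
  qed
  hence PK: "?P (uedges ?K) = {\<pi>. \<pi> permutes ?A}" by auto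
  have K: "fact (verts G) = tL F ?K * k"
    using card_perms_eq_copies[of ?A F "uedges ?K"] tL_eq_card_copies[OF F(1), of ?K] F(2)
      card_permutations[of ?A "verts G"] unfolding PK vK k_def by simp
  have G: "card (?P (uedges G)) = tL F G * k"
    using card_perms_eq_copies[of ?A F "uedges G"] tL_eq_card_copies[OF F] unfolding k_def by simp
  have "(\<Sum>\<pi> | \<pi> permutes ?A. \<Prod>(i, j)\<in>edges F. adj G (\<pi> i) (\<pi> j)) = real (card (?P (uedges G)))"
    unfolding prod_adj[OF finite_edges[OF F(1)]] using fin
    by (simp add: sum.If_cases of_bool_def Int_def)
  moreover have "(fact (verts G) :: real) = real (tL F ?K) * real k"
    using arg_cong[OF K, of real] by simp
  ultimately have "perm_avg F (verts G) (adj G) = real (tL F G * k) / (real (tL F ?K) * real k)"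
    unfolding perm_avg_def G by simp
  also have "\<dots> = tdens F G" using k F(2) by (simp add: tdens_def)
  finally show ?thesis by simp
qed

section \<open>Sampling vertices\<close>

lemma adj_nonneg: "0 \<le> adj G u v" and adj_le_1: "adj G u v \<le> 1" and adj_commute: "adj G u v = adj G v u"
  by (auto simp: adj_def insert_commute)

lemma prod_adj_bounds: "0 \<le> (\<Prod>(i, j)\<in>E. adj G (f i) (f j))" "(\<Prod>(i, j)\<in>E. adj G (f i) (f j)) \<le> 1"
  by (auto intro!: prod_nonneg prod_le_1 simp: adj_nonneg adj_le_1)

lemma hompoly_eq:
  "hompoly F n x = (\<Sum>\<phi>\<in>{0..<verts F} \<rightarrow>\<^sub>E {0..<n}. \<Prod>(i, j)\<in>edges F. x (\<phi> i) (\<phi> j)) / real n ^ verts F"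
  by (simp add: hompoly_def power_int_minus divide_inverse mult.commute)

lemma perm_average_bounds:
  assumes "\<And>\<pi>. \<pi> permutes {0..<N} \<Longrightarrow> 0 \<le> f \<pi> \<and> f \<pi> \<le> (1::real)"
  shows "0 \<le> (\<Sum>\<pi> | \<pi> permutes {0..<N}. f \<pi>) / fact N \<and> (\<Sum>\<pi> | \<pi> permutes {0..<N}. f \<pi>) / fact N \<le> 1"
proof -
  have "0 \<le> (\<Sum>\<pi> | \<pi> permutes {0..<N}. f \<pi>)" using assms by (intro sum_nonneg) auto
  moreover have "(\<Sum>\<pi> | \<pi> permutes {0..<N}. f \<pi>) \<le> (\<Sum>\<pi> | \<pi> permutes {0..<N}. 1)"
    using assms by (intro sum_mono) auto
  moreover have "(\<Sum>\<pi> | \<pi> permutes {0..<N}. 1) = (fact N :: real)"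
    using card_permutations[of "{0..<N}" N] by simp
  ultimately show ?thesis by (simp add: divide_le_eq)
qed

lemma perm_avg_adj_bounds: "0 \<le> perm_avg F N (adj G) \<and> perm_avg F N (adj G) \<le> 1"
  unfolding perm_avg_def by (intro perm_average_bounds conjI prod_adj_bounds)

section \<open>Counting non-injective maps\<close>

text \<open>The value at \<open>b\<close> can be overwritten in \<open>n\<close> ways and recovered
  from the value at \<open>a\<close>, so \<open>n\<close> times as many maps embed into all
  maps.\<close>

lemma card_collisions:
  assumes "finite A" "b \<in> A" "a \<noteq> b"
  shows "card {\<phi> \<in> A \<rightarrow>\<^sub>E {0..<n}. \<phi> a = \<phi> b} * n \<le> n ^ card A"
proof -
  let ?B = "{\<phi> \<in> A \<rightarrow>\<^sub>E {0..<n}. \<phi> a = \<phi> b}"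
  have "inj_on (\<lambda>(\<phi>, c). \<phi>(b := c)) (?B \<times> {0..<n})"
  proof (rule inj_onI, clarify)
    fix \<phi> c \<psi> c' assume eq: "\<phi>(b := c) = \<psi>(b := c')" and "\<phi> a = \<phi> b" "\<psi> a = \<psi> b"
    have ne: "\<phi> x = \<psi> x" if "x \<noteq> b" for x using fun_cong[OF eq, of x] that by simp
    have "\<phi> x = \<psi> x" for x
      using ne[of x] ne[of a] assms(3) \<open>\<phi> a = \<phi> b\<close> \<open>\<psi> a = \<psi> b\<close> by (cases "x = b") auto
    moreover have "c = c'" using fun_cong[OF eq, of b] by simp
    ultimately show "\<phi> = \<psi> \<and> c = c'" by auto
  qed
  hence "card ?B * n = card ((\<lambda>(\<phi>, c). \<phi>(b := c)) ` (?B \<times> {0..<n}))"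
    by (simp add: card_image card_cartesian_product)
  also have "\<dots> \<le> card (A \<rightarrow>\<^sub>E {0..<n})"
  proof (rule card_mono)
    show "finite (A \<rightarrow>\<^sub>E {0..<n})" using assms(1) by (intro finite_PiE) auto
    show "(\<lambda>(\<phi>, c). \<phi>(b := c)) ` (?B \<times> {0..<n}) \<subseteq> A \<rightarrow>\<^sub>E {0..<n}"
    proof clarify
      fix \<phi> c assume "\<phi> \<in> A \<rightarrow>\<^sub>E {0..<n}" "c \<in> {0..<n}"
      then show "\<phi>(b := c) \<in> A \<rightarrow>\<^sub>E {0..<n}"
        using assms(2) by (auto simp: PiE_iff extensional_def)
    qed
  qed
  also have "\<dots> = n ^ card A" using assms(1) by (simp add: card_PiE)
  finally show ?thesis .
qed

text \<open>A union bound over the ordered pairs of distinct elements of \<open>S\<close>.\<close>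

lemma card_noninjective:
  assumes "finite A" "S \<subseteq> A"
  shows "card {\<phi> \<in> A \<rightarrow>\<^sub>E {0..<n}. \<not> inj_on \<phi> S} * n \<le> card S ^ 2 * n ^ card A"
proof -
  let ?\<Phi> = "A \<rightarrow>\<^sub>E {0..<n}"
  let ?D = "{(a, b). a \<in> S \<and> b \<in> S \<and> a \<noteq> b}"
  have fS: "finite S" using assms finite_subset by blast
  have fD: "finite ?D" by (rule finite_subset[of _ "S \<times> S"]) (use fS in auto)
  have "{\<phi> \<in> ?\<Phi>. \<not> inj_on \<phi> S} \<subseteq> (\<Union>(a, b)\<in>?D. {\<phi> \<in> ?\<Phi>. \<phi> a = \<phi> b})"
    by (auto simp: inj_on_def)
  hence "card {\<phi> \<in> ?\<Phi>. \<not> inj_on \<phi> S} \<le> card (\<Union>(a, b)\<in>?D. {\<phi> \<in> ?\<Phi>. \<phi> a = \<phi> b})"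
    using fD assms(1) by (intro card_mono) (auto intro!: finite_PiE)
  also have "\<dots> \<le> (\<Sum>(a, b)\<in>?D. card {\<phi> \<in> ?\<Phi>. \<phi> a = \<phi> b})"
    using card_UN_le[OF fD, of "\<lambda>(a, b). {\<phi> \<in> ?\<Phi>. \<phi> a = \<phi> b}"] by (simp add: split_beta)
  finally have "card {\<phi> \<in> ?\<Phi>. \<not> inj_on \<phi> S} * n \<le> (\<Sum>(a, b)\<in>?D. card {\<phi> \<in> ?\<Phi>. \<phi> a = \<phi> b}) * n"
    by (rule mult_right_mono) simp
  also have "\<dots> = (\<Sum>(a, b)\<in>?D. card {\<phi> \<in> ?\<Phi>. \<phi> a = \<phi> b} * n)"
    by (simp add: sum_distrib_right split_beta)
  also have "\<dots> \<le> (\<Sum>(a, b)\<in>?D. n ^ card A)"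
    using assms by (intro sum_mono) (auto intro!: card_collisions)
  also have "\<dots> = card ?D * n ^ card A" by (simp add: split_beta)
  also have "\<dots> \<le> card (S \<times> S) * n ^ card A"
    using fS by (intro mult_right_mono card_mono) auto
  also have "card (S \<times> S) = card S ^ 2" by (simp add: card_cartesian_product power2_eq_square)
  finally show ?thesis .
qed

text \<open>Only the values of \<phi> at endpoints of edges enter. There \<phi> agrees with a
  permutation \<sigma>, and the sum over all \<pi> is invariant under \<pi> \<mapsto> \<pi> \<circ>
  \<sigma>.\<close>

lemma perm_average_injective_map:
  assumes F: "simple_graph F" "verts F \<le> N" and n: "n \<le> N"
    and \<phi>: "\<phi> \<in> {0..<verts F} \<rightarrow>\<^sub>E {0..<n}" "inj_on \<phi> (fst ` edges F \<union> snd ` edges F)"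
  shows "(\<Sum>\<pi> | \<pi> permutes {0..<N}. \<Prod>(i, j)\<in>edges F. y (\<pi> (\<phi> i)) (\<pi> (\<phi> j))) / fact N = perm_avg F N y"
proof -
  let ?S = "fst ` edges F \<union> snd ` edges F"
  have S: "?S \<subseteq> {0..<verts F}" using simple_graph_edge[OF F(1)] by force
  have "?S \<subseteq> {0..<N}" using S F(2) by auto
  moreover have "\<phi> ` ?S \<subseteq> {0..<N}"
  proof clarify
    fix s assume "s \<in> ?S"
    with S \<phi>(1) have "\<phi> s \<in> {0..<n}" by (metis PiE_mem subsetD)
    with n show "\<phi> s \<in> {0..<N}" by simp
  qed
  ultimately obtain \<sigma> where \<sigma>: "\<sigma> permutes {0..<N}" "\<And>x. x \<in> ?S \<Longrightarrow> \<sigma> x = \<phi> x"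
    by (rule extend_inj_to_permutation[OF finite_atLeastLessThan _ _ \<phi>(2)]) blast
  have "(\<Sum>\<pi> | \<pi> permutes {0..<N}. \<Prod>(i, j)\<in>edges F. y (\<pi> (\<phi> i)) (\<pi> (\<phi> j))) =
    (\<Sum>\<pi> | \<pi> permutes {0..<N}. \<Prod>(i, j)\<in>edges F. y ((\<pi> \<circ> \<sigma>) i) ((\<pi> \<circ> \<sigma>) j))"
  proof (intro sum.cong refl prod.cong, clarify)
    fix \<pi> i j assume "(i, j) \<in> edges F"
    then have "i \<in> ?S" "j \<in> ?S" by force+
    then show "y (\<pi> (\<phi> i)) (\<pi> (\<phi> j)) = y ((\<pi> \<circ> \<sigma>) i) ((\<pi> \<circ> \<sigma>) j)" using \<sigma>(2) by simp
  qed
  also have "\<dots> = (\<Sum>\<pi> | \<pi> permutes {0..<N}. \<Prod>(i, j)\<in>edges F. y (\<pi> i) (\<pi> j))"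
    by (rule sum_permutations_compose_right[OF \<sigma>(1), symmetric])
  finally show ?thesis by (simp add: perm_avg_def)
qed

text \<open>Exchanging the two averages leaves an average over \<phi> of terms
  \<open>h \<phi>\<close>, equal to the density when \<phi> is injective on the endpoints of edges
  and off by at most 1 otherwise. There are at most \<open>2 * e\<close> endpoints, so the
  exceptional \<phi> have proportion at most \<open>(2 * e)^2 / n\<close>, whatever the number of
  vertices of \<open>F\<close>.\<close>

lemma hompoly_average_near_tdens:
  assumes F: "simple_graph F" "card (edges F) \<le> e" "verts F \<le> verts G" and n: "0 < n" "n \<le> verts G"
  shows "\<bar>(\<Sum>\<pi> | \<pi> permutes {0..<verts G}. hompoly F n (\<lambda>a b. adj G (\<pi> a) (\<pi> b))) / fact (verts G)
           - tdens F G\<bar> \<le> 4 * real e ^ 2 / real n"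
proof -
  let ?N = "verts G" and ?\<Phi> = "{0..<verts F} \<rightarrow>\<^sub>E {0..<n}"
  let ?S = "fst ` edges F \<union> snd ` edges F"
  define t where "t = tdens F G"
  have t: "t = perm_avg F ?N (adj G)" unfolding t_def by (rule tdens_eq_perm_avg[OF F(1,3)])
  define h where "h \<phi> = (\<Sum>\<pi> | \<pi> permutes {0..<?N}. \<Prod>(i, j)\<in>edges F. adj G (\<pi> (\<phi> i)) (\<pi> (\<phi> j))) / fact ?N"
    for \<phi> :: "nat \<Rightarrow> nat"
  have fin: "finite ?\<Phi>" by (intro finite_PiE) auto
  have card: "card ?\<Phi> = n ^ verts F" by (simp add: card_PiE)
  have fE: "finite (edges F)" by (rule finite_edges[OF F(1)])
  have S: "?S \<subseteq> {0..<verts F}" using simple_graph_edge[OF F(1)] by force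
  have "card ?S \<le> card (fst ` edges F) + card (snd ` edges F)" by (rule card_Un_le)
  also have "\<dots> \<le> 2 * e"
    using card_image_le[OF fE, of fst] card_image_le[OF fE, of snd] F(2) by linarith
  finally have cS: "card ?S \<le> 2 * e" .
  have h_t: "\<bar>h \<phi> - t\<bar> \<le> of_bool (\<not> inj_on \<phi> ?S)" if "\<phi> \<in> ?\<Phi>" for \<phi>
  proof (cases "inj_on \<phi> ?S")
    case True
    then show ?thesis
      using perm_average_injective_map[OF F(1,3) n(2) that True, of "adj G"] by (simp add: h_def t)
  next
    case False
    have "0 \<le> h \<phi> \<and> h \<phi> \<le> 1"
      unfolding h_def by (intro perm_average_bounds conjI prod_adj_bounds)
    moreover have "0 \<le> t \<and> t \<le> 1" unfolding t by (rule perm_avg_adj_bounds)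
    ultimately show ?thesis using False by (simp add: abs_le_iff)
  qed
  have "(\<Sum>\<pi> | \<pi> permutes {0..<?N}. hompoly F n (\<lambda>a b. adj G (\<pi> a) (\<pi> b))) / fact ?N =
      (\<Sum>\<phi>\<in>?\<Phi>. h \<phi>) / real n ^ verts F"
    unfolding hompoly_eq h_def sum_divide_distrib
    by (subst sum.swap) (simp add: divide_simps mult.commute)
  moreover have "(\<Sum>\<phi>\<in>?\<Phi>. h \<phi>) / real n ^ verts F - t = (\<Sum>\<phi>\<in>?\<Phi>. h \<phi> - t) / real n ^ verts F"
    using n(1) by (simp add: sum_subtractf diff_divide_distrib card)
  ultimately have "\<bar>(\<Sum>\<pi> | \<pi> permutes {0..<?N}. hompoly F n (\<lambda>a b. adj G (\<pi> a) (\<pi> b))) / fact ?N - t\<bar>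
      = \<bar>\<Sum>\<phi>\<in>?\<Phi>. h \<phi> - t\<bar> / real n ^ verts F"
    by (simp only:) simp
  also have "\<dots> \<le> (\<Sum>\<phi>\<in>?\<Phi>. of_bool (\<not> inj_on \<phi> ?S)) / real n ^ verts F"
    using h_t by (intro divide_right_mono order_trans[OF sum_abs] sum_mono) auto
  also have "\<dots> = real (card {\<phi> \<in> ?\<Phi>. \<not> inj_on \<phi> ?S}) / real n ^ verts F"
    using fin by (simp add: Int_def)
  also have "\<dots> \<le> 4 * real e ^ 2 / real n"
  proof -
    have "card {\<phi> \<in> ?\<Phi>. \<not> inj_on \<phi> ?S} * n \<le> card ?S ^ 2 * n ^ verts F"
      using card_noninjective[OF _ S, of n] by simp
    also have "\<dots> \<le> (2 * e) ^ 2 * n ^ verts F"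
      using cS by (intro mult_right_mono power_mono) auto
    finally have "real (card {\<phi> \<in> ?\<Phi>. \<not> inj_on \<phi> ?S} * n) \<le> real ((2 * e) ^ 2 * n ^ verts F)"
      by (rule of_nat_mono)
    then show ?thesis using n(1) by (simp add: field_simps power_mult_distrib)
  qed
  finally show ?thesis unfolding t_def .
qed

section \<open>Random graphs\<close>

text \<open>The probability that a random subset, with independent elements, contains
  \<open>T\<close>. Expanding the product of \<open>p e + ?q e\<close> over \<open>P\<close> proves
  it: \<open>?q\<close> vanishes on \<open>T\<close>, which kills all \<open>X\<close> missing part
  of \<open>T\<close>, and each factor outside \<open>T\<close> is 1.\<close>

lemma sum_random_subset:
  fixes p :: "'a \<Rightarrow> real"
  assumes "finite P" "T \<subseteq> P"
  shows "(\<Sum>X\<in>Pow P. (\<Prod>e\<in>X. p e) * (\<Prod>e\<in>P - X. 1 - p e) * of_bool (T \<subseteq> X)) = (\<Prod>e\<in>T. p e)"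
proof -
  let ?q = "\<lambda>e. if e \<in> T then 0 else 1 - p e"
  have "(\<Prod>e\<in>P. p e + ?q e) = (\<Sum>X\<in>Pow P. (\<Prod>e\<in>X. p e) * (\<Prod>e\<in>P - X. ?q e))"
    by (rule prod_add[OF assms(1)])
  moreover have "(\<Prod>e\<in>P - X. ?q e) = (\<Prod>e\<in>P - X. 1 - p e) * of_bool (T \<subseteq> X)" for X
  proof (cases "T \<subseteq> X")
    case True
    then show ?thesis by (auto intro!: prod.cong)
  next
    case False
    then obtain e where "e \<in> P - X" "e \<in> T" using assms(2) by blast
    then have "(\<Prod>e\<in>P - X. ?q e) = 0"
      using assms(1) by (intro prod_zero) (auto intro!: bexI[of _ e])
    with False show ?thesis by simp
  qed
  moreover have "(\<Prod>e\<in>P. p e + ?q e) = (\<Prod>e\<in>T. p e)"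
    using assms by (intro prod.mono_neutral_cong_right) auto
  ultimately show ?thesis by (simp add: mult.assoc)
qed

definition vpairs :: "nat \<Rightarrow> (nat \<times> nat) set" where
  "vpairs N = {(i, j). i < j \<and> j < N}"

lemma finite_vpairs: "finite (vpairs N)"
  by (rule finite_subset[of _ "{0..<N} \<times> {0..<N}"]) (auto simp: vpairs_def)

lemma adj_pair:
  assumes "X \<subseteq> vpairs N" "u \<noteq> v"
  shows "adj (N, X) u v = of_bool ((min u v, max u v) \<in> X)"
proof -
  have "{u, v} \<in> uedges (N, X) \<longleftrightarrow> (min u v, max u v) \<in> X"
    using assms by (force simp: uedges_def edges_def vpairs_def doubleton_eq_iff min_def max_def image_iff)
  thus ?thesis by (simp add: adj_def)
qed

text \<open>The probability of the edge set \<open>X\<close> in the random graph on \<open>N\<close> vertices that contains the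
  edge \<open>ab\<close> with probability \<open>y a b\<close>, independently for all pairs.\<close>

definition edge_weight :: "nat \<Rightarrow> (nat \<Rightarrow> nat \<Rightarrow> real) \<Rightarrow> (nat \<times> nat) set \<Rightarrow> real" where
  "edge_weight N y X = (\<Prod>(a, b)\<in>X. y a b) * (\<Prod>(a, b)\<in>vpairs N - X. 1 - y a b)"

lemma sum_edge_weight_superset:
  assumes "T \<subseteq> vpairs N"
  shows "(\<Sum>X\<in>Pow (vpairs N). edge_weight N y X * of_bool (T \<subseteq> X)) = (\<Prod>(a, b)\<in>T. y a b)"
  using sum_random_subset[OF finite_vpairs assms, of "\<lambda>(a, b). y a b"]
  by (simp add: edge_weight_def split_beta)

lemma sum_edge_weight: "(\<Sum>X\<in>Pow (vpairs N). edge_weight N y X) = 1"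
  using sum_edge_weight_superset[of "{}" N y] by simp

lemma edge_weight_nonneg:
  assumes "\<And>a b. a < N \<Longrightarrow> b < N \<Longrightarrow> 0 \<le> y a b \<and> y a b \<le> 1" "X \<subseteq> vpairs N"
  shows "0 \<le> edge_weight N y X"
  unfolding edge_weight_def using assms
  by (intro mult_nonneg_nonneg prod_nonneg) (auto simp: vpairs_def)

text \<open>The expected density in the random graph. For a fixed permutation the edges of
  \<open>F\<close> go to distinct pairs, so independence turns the expectation of the product into
  the product of the \<open>y\<close> values.\<close>

lemma sum_edge_weight_perm_avg:
  assumes F: "simple_graph F" "verts F \<le> N" and y: "\<And>a b. a < N \<Longrightarrow> b < N \<Longrightarrow> y a b = y b a"
  shows "(\<Sum>X\<in>Pow (vpairs N). edge_weight N y X * perm_avg F N (adj (N, X))) = perm_avg F N y"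
proof -
  have "(\<Sum>X\<in>Pow (vpairs N). edge_weight N y X * (\<Prod>(i, j)\<in>edges F. adj (N, X) (\<pi> i) (\<pi> j))) =
      (\<Prod>(i, j)\<in>edges F. y (\<pi> i) (\<pi> j))" if \<pi>: "\<pi> permutes {0..<N}" for \<pi>
  proof -
    let ?g = "\<lambda>(i, j). (min (\<pi> i) (\<pi> j), max (\<pi> i) (\<pi> j))"
    have E: "i < j \<and> \<pi> i < N \<and> \<pi> j < N \<and> \<pi> i \<noteq> \<pi> j" if "(i, j) \<in> edges F" for i j
      using simple_graph_edge[OF F(1) that] F(2) permutes_in_image[OF \<pi>, of i]
        permutes_in_image[OF \<pi>, of j] permutes_inj[OF \<pi>] by (auto simp: inj_eq)
    have sub: "?g ` edges F \<subseteq> vpairs N"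
      using E by (fastforce simp: vpairs_def min_def max_def)
    \<comment> \<open>Without this a pair could contribute its probability twice. Equal images leave
      only equal or reversed edges, and reversal contradicts the increasing order of
      endpoints.\<close>
    have inj: "inj_on ?g (edges F)"
    proof (rule inj_onI, clarify)
      fix i j k l assume ij: "(i, j) \<in> edges F" and kl: "(k, l) \<in> edges F"
        and eq: "min (\<pi> i) (\<pi> j) = min (\<pi> k) (\<pi> l)" "max (\<pi> i) (\<pi> j) = max (\<pi> k) (\<pi> l)"
      have "\<pi> i = \<pi> k \<and> \<pi> j = \<pi> l \<or> \<pi> i = \<pi> l \<and> \<pi> j = \<pi> k"
        using eq by (auto simp: min_def max_def split: if_splits)
      then have "i = k \<and> j = l \<or> i = l \<and> j = k"
        using permutes_inj[OF \<pi>] by (simp add: inj_eq)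
      then show "i = k \<and> j = l" using E[OF ij] E[OF kl] by auto
    qed
    have "(\<Prod>(i, j)\<in>edges F. adj (N, X) (\<pi> i) (\<pi> j)) = of_bool (?g ` edges F \<subseteq> X)"
      if X: "X \<subseteq> vpairs N" for X
    proof -
      have "(\<Prod>(i, j)\<in>edges F. adj (N, X) (\<pi> i) (\<pi> j)) = (\<Prod>a\<in>edges F. of_bool (?g a \<in> X))"
        using E by (intro prod.cong) (auto simp: adj_pair[OF X])
      also have "\<dots> = of_bool (?g ` edges F \<subseteq> X)"
      proof (cases "?g ` edges F \<subseteq> X")
        case True
        then show ?thesis by (auto intro!: prod.neutral)
      next
        case False
        then obtain a where "a \<in> edges F" "?g a \<notin> X" by blast
        then have "(\<Prod>a\<in>edges F. of_bool (?g a \<in> X)) = (0::real)"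
          using finite_edges[OF F(1)] by (intro prod_zero) (auto intro!: bexI[of _ a])
        with False show ?thesis by simp
      qed
      finally show ?thesis .
    qed
    then have "(\<Sum>X\<in>Pow (vpairs N). edge_weight N y X * (\<Prod>(i, j)\<in>edges F. adj (N, X) (\<pi> i) (\<pi> j))) =
      (\<Sum>X\<in>Pow (vpairs N). edge_weight N y X * of_bool (?g ` edges F \<subseteq> X))"
      by (intro sum.cong) auto
    also have "\<dots> = (\<Prod>(a, b)\<in>?g ` edges F. y a b)" by (rule sum_edge_weight_superset[OF sub])
    also have "\<dots> = (\<Prod>e\<in>edges F. (case ?g e of (a, b) \<Rightarrow> y a b))"
      by (rule prod.reindex_cong[OF inj]) auto
    also have "\<dots> = (\<Prod>(i, j)\<in>edges F. y (\<pi> i) (\<pi> j))"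
      using E y by (intro prod.cong) (auto simp: min_def max_def)
    finally show ?thesis .
  qed
  then have "(\<Sum>\<pi> | \<pi> permutes {0..<N}. \<Sum>X\<in>Pow (vpairs N).
        edge_weight N y X * (\<Prod>(i, j)\<in>edges F. adj (N, X) (\<pi> i) (\<pi> j))) =
      (\<Sum>\<pi> | \<pi> permutes {0..<N}. \<Prod>(i, j)\<in>edges F. y (\<pi> i) (\<pi> j))"
    by (intro sum.cong) auto
  moreover have "(\<Sum>X\<in>Pow (vpairs N). edge_weight N y X * perm_avg F N (adj (N, X))) =
      (\<Sum>X\<in>Pow (vpairs N). \<Sum>\<pi> | \<pi> permutes {0..<N}.
        edge_weight N y X * (\<Prod>(i, j)\<in>edges F. adj (N, X) (\<pi> i) (\<pi> j))) / fact N"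
    by (simp add: perm_avg_def sum_distrib_left sum_divide_distrib)
  ultimately show ?thesis
    by (subst (asm) sum.swap) (simp add: perm_avg_def)
qed

section \<open>Random maps into n classes\<close>

text \<open>Each argument from \<open>m\<close> on is free and contributes a factor
  \<open>n\<close>. The condition on \<open>h\<close> is about total functions because elements of
  the two function spaces differ outside the smaller domain.\<close>

lemma sum_PiE_depends_on_initial:
  fixes h :: "(nat \<Rightarrow> nat) \<Rightarrow> real"
  assumes "m \<le> N" and h: "\<And>\<psi> \<psi>'. (\<And>i. i < m \<Longrightarrow> \<psi> i = \<psi>' i) \<Longrightarrow> h \<psi> = h \<psi>'"
  shows "(\<Sum>\<psi>\<in>{0..<N} \<rightarrow>\<^sub>E {0..<n}. h \<psi>) = real n ^ (N - m) * (\<Sum>\<phi>\<in>{0..<m} \<rightarrow>\<^sub>E {0..<n}. h \<phi>)"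
  using assms(1)
proof (induction N rule: dec_induct)
  case (step k)
  have "(\<Sum>\<psi>\<in>{0..<Suc k} \<rightarrow>\<^sub>E {0..<n}. h \<psi>) =
      (\<Sum>\<psi>\<in>(\<lambda>(c, \<psi>). \<psi>(k := c)) ` ({0..<n} \<times> ({0..<k} \<rightarrow>\<^sub>E {0..<n})). h \<psi>)"
    by (simp add: atLeast0_lessThan_Suc PiE_insert_eq)
  also have "\<dots> = (\<Sum>(c, \<psi>)\<in>{0..<n} \<times> ({0..<k} \<rightarrow>\<^sub>E {0..<n}). h (\<psi>(k := c)))"
    by (subst sum.reindex[OF inj_combinator]) (auto simp: split_beta)
  also have "\<dots> = (\<Sum>(c, \<psi>)\<in>{0..<n} \<times> ({0..<k} \<rightarrow>\<^sub>E {0..<n}). h \<psi>)"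
    using step(1) by (auto intro!: sum.cong h)
  also have "\<dots> = real n * (\<Sum>\<psi>\<in>{0..<k} \<rightarrow>\<^sub>E {0..<n}. h \<psi>)"
    by (simp flip: sum.cartesian_product)
  finally show ?case using step by (simp add: Suc_diff_le)
qed simp

lemma sum_PiE_compose_permutation:
  assumes "\<pi> permutes A"
  shows "(\<Sum>\<psi>\<in>A \<rightarrow>\<^sub>E B. h (\<psi> \<circ> \<pi>)) = (\<Sum>\<psi>\<in>A \<rightarrow>\<^sub>E B. h \<psi>)"
proof -
  have "\<psi> \<circ> \<sigma> \<in> A \<rightarrow>\<^sub>E B" if "\<sigma> permutes A" "\<psi> \<in> A \<rightarrow>\<^sub>E B" for \<sigma> \<psi>
    using that by (auto simp: PiE_iff extensional_def permutes_in_image permutes_not_in)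
  with assms show ?thesis
    by (intro sum.reindex_bij_witness[where j = "\<lambda>\<psi>. \<psi> \<circ> \<pi>" and i = "\<lambda>\<psi>. \<psi> \<circ> inv \<pi>"])
      (auto simp: permutes_inv fun_eq_iff permutes_inverses)
qed

text \<open>For a uniformly random \<psi>, composing with \<pi> does not change the distribution, so
  the average over \<pi> disappears; the \<open>N - verts F\<close> remaining vertices are summed
  out freely.\<close>

lemma sum_perm_avg_eq_hompoly:
  assumes F: "simple_graph F" "verts F \<le> N" and n: "0 < n"
  shows "(\<Sum>\<psi>\<in>{0..<N} \<rightarrow>\<^sub>E {0..<n}. perm_avg F N (\<lambda>a b. x (\<psi> a) (\<psi> b)) / real n ^ N) = hompoly F n x"
proof -
  let ?\<Psi> = "{0..<N} \<rightarrow>\<^sub>E {0..<n}"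
  define h :: "(nat \<Rightarrow> nat) \<Rightarrow> real" where "h \<psi> = (\<Prod>(i, j)\<in>edges F. x (\<psi> i) (\<psi> j))" for \<psi>
  have "(\<Sum>\<psi>\<in>?\<Psi>. \<Sum>\<pi> | \<pi> permutes {0..<N}. h (\<psi> \<circ> \<pi>)) = (\<Sum>\<pi> | \<pi> permutes {0..<N}. \<Sum>\<psi>\<in>?\<Psi>. h \<psi>)"
    by (subst sum.swap) (simp add: sum_PiE_compose_permutation)
  also have "\<dots> = fact N * (\<Sum>\<psi>\<in>?\<Psi>. h \<psi>)"
    using card_permutations[of "{0..<N}" N] by simp
  also have "(\<Sum>\<psi>\<in>?\<Psi>. h \<psi>) = real n ^ (N - verts F) * (\<Sum>\<phi>\<in>{0..<verts F} \<rightarrow>\<^sub>E {0..<n}. h \<phi>)"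
  proof (rule sum_PiE_depends_on_initial[OF F(2)])
    fix \<psi> \<psi>' :: "nat \<Rightarrow> nat" assume "\<And>i. i < verts F \<Longrightarrow> \<psi> i = \<psi>' i"
    then have "x (\<psi> i) (\<psi> j) = x (\<psi>' i) (\<psi>' j)" if "(i, j) \<in> edges F" for i j
      using simple_graph_edge[OF F(1) that] by simp
    then show "h \<psi> = h \<psi>'" by (auto simp: h_def intro!: prod.cong)
  qed
  finally have *: "(\<Sum>\<psi>\<in>?\<Psi>. \<Sum>\<pi> | \<pi> permutes {0..<N}. h (\<psi> \<circ> \<pi>)) =
    fact N * (real n ^ (N - verts F) * (\<Sum>\<phi>\<in>{0..<verts F} \<rightarrow>\<^sub>E {0..<n}. h \<phi>))" .
  have "(\<Sum>\<psi>\<in>?\<Psi>. perm_avg F N (\<lambda>a b. x (\<psi> a) (\<psi> b)) / real n ^ N) =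
    (\<Sum>\<psi>\<in>?\<Psi>. \<Sum>\<pi> | \<pi> permutes {0..<N}. h (\<psi> \<circ> \<pi>)) / (fact N * real n ^ N)"
    by (simp add: perm_avg_def h_def sum_divide_distrib)
  also have "\<dots> = (\<Sum>\<phi>\<in>{0..<verts F} \<rightarrow>\<^sub>E {0..<n}. h \<phi>) / real n ^ verts F"
    unfolding * using n F(2) by (simp add: power_diff)
  finally show ?thesis by (simp add: hompoly_eq h_def)
qed

section \<open>The curvy zonotope\<close>

text \<open>A two-stage random graph: each of the \<open>N\<close> vertices gets a uniform class in
  [n], then edges are drawn independently with the probabilities \<open>x\<close> of their classes,
  the diagonal of \<open>x\<close> serving pairs inside one class. The expected density vector is
  exactly the given point, with the same weights \<open>a\<close> in every coordinate.\<close>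

lemma curvy_zonotope_subset_Pn:
  fixes F :: "'d::finite \<Rightarrow> graph"
  assumes F: "\<And>k. simple_graph (F k)" "\<And>k. verts (F k) \<le> N" and n: "0 < n"
  shows "curvy_zonotope F n \<subseteq> Pn F N"
proof
  fix v assume "v \<in> curvy_zonotope F n"
  then obtain x where v: "v = (\<chi> k. hompoly (F k) n x)"
    and x: "\<And>i j. i < n \<Longrightarrow> j < n \<Longrightarrow> 0 \<le> x i j \<and> x i j \<le> 1 \<and> x i j = x j i"
    unfolding curvy_zonotope_def by blast
  let ?\<Psi> = "{0..<N} \<rightarrow>\<^sub>E {0..<n}" and ?X = "Pow (vpairs N)"
  define a where "a = (\<lambda>(\<psi>, X). edge_weight N (\<lambda>i j. x (\<psi> i) (\<psi> j)) X / real n ^ N)"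
  define y :: "(nat \<Rightarrow> nat) \<times> (nat \<times> nat) set \<Rightarrow> real^'d"
    where "y = (\<lambda>(\<psi>, X). \<chi> k. tdens (F k) (N, X))"
  have fin: "finite (?\<Psi> \<times> ?X)" by (auto intro!: finite_PiE simp: finite_vpairs)
  have \<psi>: "\<psi> i < n" if "\<psi> \<in> ?\<Psi>" "i < N" for \<psi> i
    using PiE_mem[OF that(1), of i] that(2) by simp
  have "(\<Sum>p\<in>?\<Psi> \<times> ?X. a p *\<^sub>R y p) \<in> Pn F N"
  proof (rule convex_sum[OF fin])
    show "convex (Pn F N)" unfolding Pn_def by (rule convex_convex_hull)
    have "sum a (?\<Psi> \<times> ?X) = (\<Sum>\<psi>\<in>?\<Psi>. 1 / real n ^ N)"
      by (simp add: a_def sum.cartesian_product[symmetric] sum_divide_distrib[symmetric] sum_edge_weight)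
    also have "\<dots> = 1" using n by (simp add: card_PiE)
    finally show "sum a (?\<Psi> \<times> ?X) = 1" .
    show "0 \<le> a p" if p_mem: "p \<in> ?\<Psi> \<times> ?X" for p
    proof -
      obtain \<psi> X where p: "p = (\<psi>, X)" "\<psi> \<in> ?\<Psi>" "X \<subseteq> vpairs N" using p_mem by blast
      have "0 \<le> edge_weight N (\<lambda>i j. x (\<psi> i) (\<psi> j)) X"
        using x \<psi>[OF p(2)] by (intro edge_weight_nonneg p(3)) auto
      then show ?thesis by (simp add: a_def p(1))
    qed
    show "y p \<in> Pn F N" if p: "p \<in> ?\<Psi> \<times> ?X" for p
    proof -
      have "simple_graph (N, snd p)" "verts (N, snd p) = N"
        using p by (auto simp: simple_graph_def edges_def verts_def vpairs_def)
      moreover have "y p = (\<chi> k. tdens (F k) (N, snd p))" by (simp add: y_def split_beta)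
      ultimately show ?thesis unfolding Pn_def by (intro hull_inc) blast
    qed
  qed
  also have "(\<Sum>p\<in>?\<Psi> \<times> ?X. a p *\<^sub>R y p) = v"
  proof (rule vec_eq_iff[THEN iffD2, rule_format])
    fix k
    have t: "tdens (F k) (N, X) = perm_avg (F k) N (adj (N, X))" for X
      using tdens_eq_perm_avg[OF F(1), of k "(N, X)"] F(2) by (simp add: verts_def)
    have "(\<Sum>p\<in>?\<Psi> \<times> ?X. a p *\<^sub>R y p) $ k = (\<Sum>p\<in>?\<Psi> \<times> ?X. a p * y p $ k)"
      by simp
    also have "\<dots> = (\<Sum>\<psi>\<in>?\<Psi>. \<Sum>X\<in>?X. a (\<psi>, X) * y (\<psi>, X) $ k)"
      by (simp add: sum.cartesian_product)
    also have "\<dots> = (\<Sum>\<psi>\<in>?\<Psi>. (\<Sum>X\<in>?X. edge_weight N (\<lambda>i j. x (\<psi> i) (\<psi> j)) X *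
        perm_avg (F k) N (adj (N, X))) / real n ^ N)"
      by (simp add: a_def y_def t sum_divide_distrib)
    also have "\<dots> = (\<Sum>\<psi>\<in>?\<Psi>. perm_avg (F k) N (\<lambda>i j. x (\<psi> i) (\<psi> j)) / real n ^ N)"
      using x \<psi> by (intro sum.cong refl arg_cong2[where f = "(/)"] sum_edge_weight_perm_avg F) auto
    also have "\<dots> = hompoly (F k) n x" by (rule sum_perm_avg_eq_hompoly[OF F n])
    finally show "(\<Sum>p\<in>?\<Psi> \<times> ?X. a p *\<^sub>R y p) $ k = v $ k" by (simp add: v)
  qed
  finally show "v \<in> Pn F N" .
qed

section \<open>Approximation of density vectors by sampling\<close>

text \<open>Allows closeness to \<open>C\<close> to be checked only at the points that generate a
  hull.\<close>

lemma convex_near_convex: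
  fixes C :: "(real^'d) set"
  assumes "convex C"
  shows "convex {v. \<exists>w\<in>C. \<forall>k. \<bar>v $ k - w $ k\<bar> \<le> r}"
proof (rule convexI, clarify)
  fix v v' w w' :: "real^'d" and s t :: real
  assume st: "0 \<le> s" "0 \<le> t" "s + t = 1" and w: "w \<in> C" "w' \<in> C"
    and near: "\<forall>k. \<bar>v $ k - w $ k\<bar> \<le> r" "\<forall>k. \<bar>v' $ k - w' $ k\<bar> \<le> r"
  show "\<exists>u\<in>C. \<forall>k. \<bar>(s *\<^sub>R v + t *\<^sub>R v') $ k - u $ k\<bar> \<le> r"
  proof (intro bexI allI)
    show "s *\<^sub>R w + t *\<^sub>R w' \<in> C" using assms w st by (rule convexD)
    fix k
    have "\<bar>(s *\<^sub>R v + t *\<^sub>R v') $ k - (s *\<^sub>R w + t *\<^sub>R w') $ k\<bar>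
      = \<bar>s * (v $ k - w $ k) + t * (v' $ k - w' $ k)\<bar>" by (simp add: algebra_simps)
    also have "\<dots> \<le> s * \<bar>v $ k - w $ k\<bar> + t * \<bar>v' $ k - w' $ k\<bar>"
      using st by (intro order_trans[OF abs_triangle_ineq]) (simp add: abs_mult)
    also have "\<dots> \<le> s * r + t * r"
      using near st by (intro add_mono mult_left_mono) auto
    also have "\<dots> = r" using st(3) by (simp flip: distrib_right)
    finally show "\<bar>(s *\<^sub>R v + t *\<^sub>R v') $ k - (s *\<^sub>R w + t *\<^sub>R w') $ k\<bar> \<le> r" .
  qed
qed

lemma Pn_near_curvy_zonotope:
  fixes F :: "'d::finite \<Rightarrow> graph"
  assumes F: "\<And>k. simple_graph (F k)" "\<And>k. card (edges (F k)) \<le> e" "\<And>k. verts (F k) \<le> N"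
    and n: "0 < n" "n \<le> N" and v: "v \<in> Pn F N"
  shows "\<exists>w\<in>convex hull (curvy_zonotope F n). \<forall>k. \<bar>v $ k - w $ k\<bar> \<le> 4 * real e ^ 2 / real n"
proof -
  let ?C = "convex hull (curvy_zonotope F n)" and ?r = "4 * real e ^ 2 / real n"
  have "Pn F N \<subseteq> {v. \<exists>w\<in>?C. \<forall>k. \<bar>v $ k - w $ k\<bar> \<le> ?r}"
    unfolding Pn_def
  proof (rule hull_minimal; clarify?)
    show "convex {v. \<exists>w\<in>?C. \<forall>k. \<bar>v $ k - w $ k\<bar> \<le> ?r}"
      by (intro convex_near_convex convex_convex_hull)
    fix G assume G: "N = verts G"
    let ?P = "{\<pi>. \<pi> permutes {0..<N}}"
    \<comment> \<open>The point of the curvy zonotope given by the adjacency matrix of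
      \<open>G\<close> on the sampled vertices \<pi> 0, ..., \<pi> (n - 1).\<close>
    define z :: "(nat \<Rightarrow> nat) \<Rightarrow> real^'d"
      where "z \<pi> = (\<chi> k. hompoly (F k) n (\<lambda>a b. adj G (\<pi> a) (\<pi> b)))" for \<pi>
    have "(\<Sum>\<pi>\<in>?P. (1 / fact N) *\<^sub>R z \<pi>) \<in> ?C"
    proof (rule convex_sum)
      show "finite ?P" by (intro finite_permutations) simp
      show "(\<Sum>\<pi>\<in>?P. 1 / fact N :: real) = 1"
        using card_permutations[of "{0..<N}" N] by simp
      show "z \<pi> \<in> ?C" for \<pi>
        unfolding z_def curvy_zonotope_def
        by (rule hull_inc) (auto simp: adj_nonneg adj_le_1 intro: adj_commute)
    qed (auto simp: convex_convex_hull)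
    moreover have "\<bar>(\<chi> k. tdens (F k) G) $ k - (\<Sum>\<pi>\<in>?P. (1 / fact N) *\<^sub>R z \<pi>) $ k\<bar> \<le> ?r" for k
    proof -
      have "(\<Sum>\<pi>\<in>?P. (1 / fact N) *\<^sub>R z \<pi>) $ k =
        (\<Sum>\<pi>\<in>?P. hompoly (F k) n (\<lambda>a b. adj G (\<pi> a) (\<pi> b))) / fact N"
        by (simp add: z_def sum_divide_distrib)
      then show ?thesis
        using hompoly_average_near_tdens[OF F(1,2), of k G n] F(3)[of k] n
        by (simp add: G abs_minus_commute)
    qed
    ultimately show "\<exists>w\<in>?C. \<forall>k. \<bar>(\<chi> k. tdens (F k) G) $ k - w $ k\<bar> \<le> ?r" by blast
  qed
  with v show ?thesis by blast
qed

lemma Pn_subset_cbox: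
  fixes F :: "'d::finite \<Rightarrow> graph"
  assumes F: "\<And>k. simple_graph (F k)" "\<And>k. verts (F k) \<le> N"
  shows "Pn F N \<subseteq> cbox 0 One"
  unfolding Pn_def
proof (rule hull_minimal; clarify?)
  fix G assume "N = verts G"
  then have "0 \<le> tdens (F k) G \<and> tdens (F k) G \<le> 1" for k
    using tdens_eq_perm_avg[OF F(1), of k G] F(2)[of k] perm_avg_adj_bounds by simp
  then have "0 \<le> (\<chi> k. tdens (F k) G) \<bullet> b \<and> (\<chi> k. tdens (F k) G) \<bullet> b \<le> 1" if "b \<in> Basis" for b
    using that by (auto simp: Basis_vec_def inner_axis)
  then show "(\<chi> k. tdens (F k) G) \<in> cbox 0 One"
    by (simp add: mem_box)
qed (rule convex_box)

section \<open>Comparison of the volumes\<close>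

theorem theorem5p7:
  "\<exists>k::real. \<forall>(F :: 'd::finite \<Rightarrow> graph) (e::nat) (\<epsilon>::real) (n::nat).
     (\<forall>i. simple_graph (F i) \<and> card (edges (F i)) \<le> e) \<longrightarrow> \<epsilon> > 0 \<longrightarrow>
     real n > 2 powr (k * real (CARD('d))^2 * real e^2 / \<epsilon>^2) \<longrightarrow>
     0 \<le> measure lebesgue (Pinf F) - measure lebesgue (convex hull (curvy_zonotope F n)) \<and>
     measure lebesgue (Pinf F) - measure lebesgue (convex hull (curvy_zonotope F n)) < \<epsilon>"
proof -
  let ?d = "CARD('d)"
  \<comment> \<open>The factor of \<open>r\<close> in \<open>measure_le_of_near_convex\<close> for
    dimension d. It depends on d alone, hence so does the constant \<open>16 * D\<close>.\<close>
  define D where "D = real ?d * 3 ^ ?d * 4"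
  have d1: "real ?d \<ge> 1" using zero_less_card_finite[where 'a = 'd] by linarith
  have "1 * 1 * 4 \<le> D" unfolding D_def using d1 by (intro mult_mono) auto
  hence D: "D \<ge> 4" by simp
  show ?thesis
  proof (intro exI[of _ "16 * D"] allI impI)
    fix F :: "'d \<Rightarrow> graph" and e :: nat and \<epsilon> :: real and n :: nat
    assume FF: "\<forall>i. simple_graph (F i) \<and> card (edges (F i)) \<le> e" and \<epsilon>: "\<epsilon> > 0"
      and n: "real n > 2 powr (16 * D * real ?d ^ 2 * real e ^ 2 / \<epsilon> ^ 2)"
    have F: "simple_graph (F k)" "card (edges (F k)) \<le> e" for k using FF by auto
    let ?K = "convex hull (curvy_zonotope F n)" and ?L = "Pinf F"
    define M where "M = Max (range (\<lambda>i. verts (F i)))"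
    have M: "verts (F k) \<le> M" for k unfolding M_def by (intro Max_ge) auto
    have "0 < real n" using n powr_ge_zero[of 2] by (rule le_less_trans[rotated])
    hence n0: "0 < n" by simp
    have L: "?L = (\<Inter>N\<in>{M..}. Pn F N)" by (simp add: Pinf_def M_def)
    have Pn_convex: "convex (Pn F N)" for N unfolding Pn_def by (rule convex_convex_hull)
    have L_sub: "?L \<subseteq> cbox 0 One"
      unfolding L by (rule INF_lower2[of M]) (simp_all add: Pn_subset_cbox F(1) M)
    have L_meas: "?L \<in> lmeasurable"
      using L_sub Pn_convex
      by (intro measurable_convex) (auto simp: L intro!: convex_INT intro: bounded_subset[OF bounded_cbox])
    have K_sub: "?K \<subseteq> ?L"
      unfolding L using M Pn_convex n0
      by (intro INT_greatest hull_minimal curvy_zonotope_subset_Pn F) (auto intro: order_trans)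
    have K_box: "?K \<subseteq> cbox 0 One" using K_sub L_sub by (rule subset_trans)
    have K_meas: "?K \<in> lmeasurable"
      using K_box by (intro measurable_convex) (auto intro: bounded_subset[OF bounded_cbox])
    have ge: "0 \<le> measure lebesgue ?L - measure lebesgue ?K"
      using measure_mono_fmeasurable[OF K_sub] K_meas L_meas by (simp add: fmeasurableD)
    have "measure lebesgue ?L - measure lebesgue ?K < \<epsilon>"
    \<comment> \<open>For \<epsilon> > 1 the volume 1 of the cube suffices. Otherwise \<epsilon>
      \<le> 1 gives both \<open>4 * r\<close> \<le> 1 and the comparison of 1/\<epsilon> with the
      1/\<epsilon>-squared in the exponent.\<close>
    proof (cases "\<epsilon> > 1")
      case True
      have "measure lebesgue ?L \<le> measure lebesgue (cbox 0 (One :: real^'d))"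
        using L_sub L_meas by (intro measure_mono_fmeasurable) (auto intro: fmeasurableD)
      also have "\<dots> = 1" using content_unit[where 'a = "real^'d"] by simp
      finally have "measure lebesgue ?L \<le> 1" .
      then show ?thesis using True measure_nonneg[of lebesgue ?K] by linarith
    next
      case False
      define z where "z = 16 * D * real ?d ^ 2 * real e ^ 2 / \<epsilon> ^ 2"
      \<comment> \<open>Chosen so that \<open>D * r\<close> is \<epsilon>/2, which leaves the
        inequality strict.\<close>
      define r where "r = \<epsilon> / (2 * D)"
      have z0: "z \<ge> 0" unfolding z_def using D by simp
      \<comment> \<open>The left side is the size of \<open>n\<close> at which the sampling error
        \<open>4 * e^2 / n\<close> drops to \<open>r\<close>. The exponential is bounded below by
        its linear part only.\<close>
      have "8 * D * real e ^ 2 / \<epsilon> \<le> z / 2"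
      proof -
        have "8 * D * real e ^ 2 * \<epsilon> * 1 \<le> 8 * D * real e ^ 2 * 1 * real ?d ^ 2"
          using False \<epsilon> D d1 by (intro mult_mono) auto
        then show ?thesis using \<epsilon> by (simp add: z_def field_simps power2_eq_square)
      qed
      also have "\<dots> \<le> 1 + z * ln 2"
        using mult_left_mono[OF _ z0, of "1/2" "ln 2"] ln2_ge_two_thirds by simp
      also have "\<dots> \<le> 2 powr z" using exp_ge_add_one_self[of "z * ln 2"] by (simp add: powr_def)
      also have "\<dots> \<le> real n" using n unfolding z_def by simp
      finally have "4 * real e ^ 2 / real n \<le> r"
        using \<epsilon> D n0 by (simp add: r_def field_simps)
      moreover have "0 < r" using \<epsilon> D by (simp add: r_def)
      moreover have "4 * r \<le> 1" using \<epsilon> D False by (simp add: r_def divide_le_eq)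
      moreover have "\<exists>w\<in>?K. \<forall>b\<in>Basis. \<bar>v \<bullet> b - w \<bullet> b\<bar> \<le> r" if "v \<in> ?L" for v
      proof -
        \<comment> \<open>At least \<open>M\<close>, to be among the sets intersected in
          \<open>Pinf\<close>, and at least \<open>n\<close>, so that \<open>n\<close> vertices can
          be sampled.\<close>
        have "v \<in> Pn F (max M n)" using that unfolding L by simp
        then obtain w where "w \<in> ?K" "\<forall>k. \<bar>v $ k - w $ k\<bar> \<le> 4 * real e ^ 2 / real n"
          using Pn_near_curvy_zonotope[of F e "max M n" n v] F n0 M by (auto simp: le_max_iff_disj)
        with \<open>4 * real e ^ 2 / real n \<le> r\<close> show ?thesis
          by (intro bexI[of _ w]) (auto simp: Basis_vec_def inner_axis intro: order_trans)
      qed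
      ultimately have "measure lebesgue ?L \<le> measure lebesgue ?K + D * r"
        using measure_le_of_near_convex[OF convex_convex_hull K_box L_meas, of r]
        by (simp add: D_def)
      moreover have "D * r < \<epsilon>" using D \<epsilon> by (simp add: r_def)
      ultimately show ?thesis by linarith
    qed
    with ge show "0 \<le> measure lebesgue ?L - measure lebesgue ?K \<and>
      measure lebesgue ?L - measure lebesgue ?K < \<epsilon>" by blast
  qed
qed

end
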